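(* There exist cop-win graphs $G$ having an optimal cop strategy that is not a Lower Way strategy.
   Context: All graphs are finite, nonempty and reflexive (every vertex adjacent to itself). For distinct vertices $v,w$ of a graph $H$: $w$ corners $v$ in $H$ if every vertex of $H$ adjacent to $v$ is adjacent to $w$; $w$ strictly corners $v$ in $H$ if moreover some vertex of $H$ adjacent to $w$ is not adjacent to $v$; a strict corner of $H$ is a vertex strictly cornered in $H$ by another vertex. We also say $c$ corners $x$ in $H$ when $c=x$. Corner ranking: $G_1=G$, $k=1$. If $G_k$ is a clique, its vertices get rank $k$; stop. Else if $G_k$ has no strict corners, its vertices get rank $\infty$; stop. Else the set $X$ of strict corners of $G_k$ gets rank $k$, $G_{k+1}=G_k-X$, increase $k$, repeat. $\mathrm{cr}(v)$ is the rank of $v$, $\mathrm{cr}(G)$ the maximum rank. For finite corner rank $\alpha\ge2$: $G$ is $1$-cop-win ($r=1$) if some (equivalently every) vertex of rank $\alpha$ is adjacent to all vertices of $G_{\alpha-1}$, otherwise $0$-cop-win ($r=0$). Projections: $f_k(\{u\})=\{u\}$ if $\mathrm{cr}(u)>k$, otherwise the set of vertices of $G_{k+1}$ that strictly corner $u$ in $G_k$; $f_k(S)=\bigcup_{u\in S}f_k(\{u\})$; $F_1$ the identity, $F_k=f_{k-1}\circ\cdots\circ f_1$, $F_k(v)=F_k(\{v\})$. Game: cop places, robber places, then alternate moves with the cop first; a move is staying or moving to an adjacent vertex; the cop wins when both share a vertex. $G$ is cop-win if the cop can force a win; $\operatorname{capt}(G)$ is the minimum number of cop moves (placement not counted) guaranteeing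 a win. A cop strategy is optimal if it wins in at most $\operatorname{capt}(G)$ cop moves against every robber strategy. With the cop at $c$ and robber at $x$: $x$ is $0$-cornered if $c=x$; for $k\ge1$, $x$ is $k$-cornered by $c$ if some $x'\in F_k(x)$ is cornered by $c$ in the subgraph induced by $V(G_k)\cup\{c\}$. A standard initial placement is a vertex adjacent to every vertex of $G_{\alpha-r}$. A Lower Way strategy has a standard initial placement and, for every $t\ge1$, after $t$ cop moves the cop $k$-corners the robber for some $k\le\alpha-r-t$. *)

theory Defs
  imports Main "HOL-Library.Extended_Nat"
begin

section \<open>Plays of the game\<close>

text \<open>
  A history is the list of rounds played so far, oldest first; a round is a cop position followed
  by the robber position chosen in reply. Round 0 consists of the two initial placements, so after
  round \<open>t\<close> the cop has made exactly \<open>t\<close> moves. Strategies are deterministic and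
  may depend on the whole history: a cop strategy maps the empty history to the initial placement
  and any other history to the next position of the cop; a robber strategy also receives the cop
  position chosen in the current round.
\<close>

type_synonym 'a history = "('a \<times> 'a) list"
type_synonym 'a cop_strat = "'a history \<Rightarrow> 'a"
type_synonym 'a robber_strat = "'a history \<Rightarrow> 'a \<Rightarrow> 'a"

primrec play :: "'a cop_strat \<Rightarrow> 'a robber_strat \<Rightarrow> nat \<Rightarrow> 'a history" where
  "play \<sigma> \<rho> 0 = []"
| "play \<sigma> \<rho> (Suc n) =
     play \<sigma> \<rho> n @ [(\<sigma> (play \<sigma> \<rho> n), \<rho> (play \<sigma> \<rho> n) (\<sigma> (play \<sigma> \<rho> n)))]"

definition cop_pos :: "'a cop_strat \<Rightarrow> 'a robber_strat \<Rightarrow> nat \<Rightarrow> 'a" where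
  "cop_pos \<sigma> \<rho> t = \<sigma> (play \<sigma> \<rho> t)"

definition robber_pos :: "'a cop_strat \<Rightarrow> 'a robber_strat \<Rightarrow> nat \<Rightarrow> 'a" where
  "robber_pos \<sigma> \<rho> t = \<rho> (play \<sigma> \<rho> t) (cop_pos \<sigma> \<rho> t)"

text \<open>
  The two disjuncts are the two ways of sharing a vertex: the robber placed himself on or moved
  onto the cop, or the cop's \<open>t\<close>-th move reached the robber, who is still where he was
  after round \<open>t - 1\<close>. Plays formally continue after a capture, but only what happens up
  to the first capture matters below.
\<close>

definition won_within :: "'a cop_strat \<Rightarrow> 'a robber_strat \<Rightarrow> nat \<Rightarrow> bool" where
  "won_within \<sigma> \<rho> n \<longleftrightarrow>
     (\<exists>t\<le>n. robber_pos \<sigma> \<rho> t = cop_pos \<sigma> \<rho> t \<or>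
            (t \<ge> 1 \<and> cop_pos \<sigma> \<rho> t = robber_pos \<sigma> \<rho> (t - 1)))"

section \<open>Finite reflexive graphs\<close>

locale reflexive_graph =
  fixes V :: "'a set" and E :: "'a rel"
  assumes finite_V: "finite V"
    and nonempty_V: "V \<noteq> {}"
    and edges_in_V: "E \<subseteq> V \<times> V"
    and refl_E: "refl_on V E"
    and sym_E: "sym E"
begin

subsection \<open>Corners and corner ranking\<close>

text \<open>Induced subgraphs are represented by their vertex sets \<open>H \<subseteq> V\<close>.\<close>

definition clique :: "'a set \<Rightarrow> bool" where
  "clique H \<longleftrightarrow> (\<forall>v\<in>H. \<forall>w\<in>H. (v, w) \<in> E)"

text \<open>The case \<open>w = v\<close> is deliberately included: every vertex corners itself.\<close>

definition corners :: "'a set \<Rightarrow> 'a \<Rightarrow> 'a \<Rightarrow> bool" where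
  "corners H w v \<longleftrightarrow> w \<in> H \<and> v \<in> H \<and> (w = v \<or> (\<forall>u\<in>H. (u, v) \<in> E \<longrightarrow> (u, w) \<in> E))"

definition strictly_corners :: "'a set \<Rightarrow> 'a \<Rightarrow> 'a \<Rightarrow> bool" where
  "strictly_corners H w v \<longleftrightarrow>
     w \<noteq> v \<and> corners H w v \<and> (\<exists>u\<in>H. (u, w) \<in> E \<and> (u, v) \<notin> E)"

definition strict_corners :: "'a set \<Rightarrow> 'a set" where
  "strict_corners H = {v \<in> H. \<exists>w\<in>H. strictly_corners H w v}"

text \<open>
  \<open>stage k\<close> is the vertex set of $G_k$ for \<open>k \<ge> 1\<close>; index 0 is a dummy. A clique has no
  strict corners, so after the ranking procedure has stopped the sequence remains constant.
\<close>

fun stage :: "nat \<Rightarrow> 'a set" where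
  "stage 0 = V"
| "stage (Suc 0) = V"
| "stage (Suc (Suc k)) = stage (Suc k) - strict_corners (stage (Suc k))"

text \<open>
  The infimum picks the step at which \<open>v\<close> is assigned its rank, and it is \<open>\<infinity>\<close> if there is
  no such step.
\<close>

definition corner_rank :: "'a \<Rightarrow> enat" where
  "corner_rank v =
     Inf {enat k | k. k \<ge> 1 \<and> v \<in> stage k \<and> (clique (stage k) \<or> v \<in> strict_corners (stage k))}"

definition graph_rank :: enat where
  "graph_rank = Max (corner_rank ` V)"

text \<open>\<open>rank_nat\<close> is the number $\alpha$; it is meaningful only if the corner rank is finite.
  The number \<open>r_val\<close> is $r$, and it is meaningful only if moreover $\alpha \ge 2$.\<close>

definition rank_nat :: nat where
  "rank_nat = the_enat graph_rank"

definition r_val :: nat where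
  "r_val = (if \<exists>v\<in>V. corner_rank v = enat rank_nat \<and> (\<forall>w\<in>stage (rank_nat - 1). (v, w) \<in> E)
            then 1 else 0)"

subsection \<open>Projections\<close>

definition proj1 :: "nat \<Rightarrow> 'a \<Rightarrow> 'a set" where
  "proj1 k u =
     (if corner_rank u > enat k then {u} else {w \<in> stage (Suc k). strictly_corners (stage k) w u})"

definition proj_step :: "nat \<Rightarrow> 'a set \<Rightarrow> 'a set" where
  "proj_step k S = (\<Union>u\<in>S. proj1 k u)"

text \<open>\<open>proj k\<close> is $F_k$ for \<open>k \<ge> 1\<close>; index 0 is a dummy.\<close>

fun proj :: "nat \<Rightarrow> 'a set \<Rightarrow> 'a set" where
  "proj 0 S = S"
| "proj (Suc 0) S = S"
| "proj (Suc (Suc k)) S = proj_step (Suc k) (proj (Suc k) S)"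

definition k_cornered :: "nat \<Rightarrow> 'a \<Rightarrow> 'a \<Rightarrow> bool" where
  "k_cornered k c x \<longleftrightarrow>
     (if k = 0 then c = x else (\<exists>x'\<in>proj k {x}. corners (stage k \<union> {c}) c x'))"

subsection \<open>Strategies\<close>

definition cop_strategy :: "'a cop_strat \<Rightarrow> bool" where
  "cop_strategy \<sigma> \<longleftrightarrow>
     \<sigma> [] \<in> V \<and> (\<forall>h. h \<noteq> [] \<and> set h \<subseteq> V \<times> V \<longrightarrow> (fst (last h), \<sigma> h) \<in> E)"

definition robber_strategy :: "'a robber_strat \<Rightarrow> bool" where
  "robber_strategy \<rho> \<longleftrightarrow>
     (\<forall>c\<in>V. \<rho> [] c \<in> V) \<and>
     (\<forall>h. \<forall>c\<in>V. h \<noteq> [] \<and> set h \<subseteq> V \<times> V \<longrightarrow> (snd (last h), \<rho> h c) \<in> E)"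

definition cop_win :: bool where
  "cop_win \<longleftrightarrow>
     (\<exists>\<sigma>. cop_strategy \<sigma> \<and> (\<forall>\<rho>. robber_strategy \<rho> \<longrightarrow> (\<exists>n. won_within \<sigma> \<rho> n)))"

definition wins_in :: "'a cop_strat \<Rightarrow> nat \<Rightarrow> bool" where
  "wins_in \<sigma> n \<longleftrightarrow> cop_strategy \<sigma> \<and> (\<forall>\<rho>. robber_strategy \<rho> \<longrightarrow> won_within \<sigma> \<rho> n)"

definition capt :: nat where
  "capt = (LEAST n. \<exists>\<sigma>. wins_in \<sigma> n)"

definition optimal :: "'a cop_strat \<Rightarrow> bool" where
  "optimal \<sigma> \<longleftrightarrow> wins_in \<sigma> capt"

definition standard_placement :: "'a \<Rightarrow> bool" where
  "standard_placement c \<longleftrightarrow> c \<in> V \<and> (\<forall>w\<in>stage (rank_nat - r_val). (c, w) \<in> E)"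

text \<open>
  The requirement concerns only cop moves that are actually made, that is, those before which the
  cop has not yet won; no strategy could satisfy it for all \<open>t \<ge> 1\<close>, since $\alpha - r - t$
  eventually becomes negative. The sum \<open>k + t + r_val \<le> rank_nat\<close> expresses
  $k \le \alpha - r - t$ without truncated subtraction.
\<close>

definition lower_way :: "'a cop_strat \<Rightarrow> bool" where
  "lower_way \<sigma> \<longleftrightarrow>
     cop_strategy \<sigma> \<and> standard_placement (\<sigma> []) \<and>
     (\<forall>\<rho> t. robber_strategy \<rho> \<and> t \<ge> 1 \<and> \<not> won_within \<sigma> \<rho> (t - 1) \<longrightarrow>
        (\<exists>k. k + t + r_val \<le> rank_nat \<and>
             k_cornered k (cop_pos \<sigma> \<rho> t) (robber_pos \<sigma> \<rho> (t - 1))))"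

end

end

theory Submission
  imports Defs
begin

text \<open>
  Take the path $1,\dots,6$ with a further leaf 7 attached to 3. Its corner ranks are 1 for the
  leaves, 2 for the vertices 2 and 5, and 3 for the vertices 3 and 4, so $\alpha = 3$ and $r = 0$;
  a robber sitting at the remoter end of the path survives two cop moves. A cop starting at 3 needs
  three moves only against a robber near 6. Against a robber placed at 7 there is time to
  waste: the cop may step to 4 and come back, which is optimal, but after that step 4 does not
  $k$-corner 7 for any $k \le 2$.
\<close>

section \<open>The tree and its adjacency\<close>

definition tree_V :: "nat set" where
  "tree_V = {1, 2, 3, 4, 5, 6, 7}"

definition tree_edges :: "nat rel" where
  "tree_edges = {(1, 2), (2, 3), (3, 4), (4, 5), (5, 6), (3, 7)}"

definition tree_E :: "nat rel" where
  "tree_E = Id_on tree_V \<union> (tree_edges \<union> tree_edges\<inverse>)"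

interpretation tree: reflexive_graph tree_V tree_E
proof
  show "finite tree_V" "tree_V \<noteq> {}"
    by (simp_all add: tree_V_def)
  have "tree_edges \<subseteq> tree_V \<times> tree_V"
    by (simp add: tree_V_def tree_edges_def)
  then show "tree_E \<subseteq> tree_V \<times> tree_V"
    unfolding tree_E_def by blast
  show "refl_on tree_V tree_E"
    by (auto simp: tree_E_def refl_on_def)
  show "sym tree_E"
    unfolding tree_E_def by (intro sym_Un sym_Id_on sym_Un_converse)
qed

text \<open>Adjacency to a concrete vertex becomes a few equations, so that the later case checks
  reduce to simplification. Vertex 1 is written \<open>Suc 0\<close> on the left because that is its
  simp normal form.\<close>

lemma tree_edge_iff:
  "(u, Suc 0) \<in> tree_E \<longleftrightarrow> u = 1 \<or> u = 2"
  "(u, 2) \<in> tree_E \<longleftrightarrow> u = 1 \<or> u = 2 \<or> u = 3"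
  "(u, 3) \<in> tree_E \<longleftrightarrow> u = 2 \<or> u = 3 \<or> u = 4 \<or> u = 7"
  "(u, 4) \<in> tree_E \<longleftrightarrow> u = 3 \<or> u = 4 \<or> u = 5"
  "(u, 5) \<in> tree_E \<longleftrightarrow> u = 4 \<or> u = 5 \<or> u = 6"
  "(u, 6) \<in> tree_E \<longleftrightarrow> u = 5 \<or> u = 6"
  "(u, 7) \<in> tree_E \<longleftrightarrow> u = 3 \<or> u = 7"
  by (simp_all add: tree_E_def Id_on_iff tree_V_def tree_edges_def cong: conj_cong)

lemma tree_edge_iff':
  "(Suc 0, v) \<in> tree_E \<longleftrightarrow> v = 1 \<or> v = 2"
  "(2, v) \<in> tree_E \<longleftrightarrow> v = 1 \<or> v = 2 \<or> v = 3"
  "(3, v) \<in> tree_E \<longleftrightarrow> v = 2 \<or> v = 3 \<or> v = 4 \<or> v = 7"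
  "(4, v) \<in> tree_E \<longleftrightarrow> v = 3 \<or> v = 4 \<or> v = 5"
  "(5, v) \<in> tree_E \<longleftrightarrow> v = 4 \<or> v = 5 \<or> v = 6"
  "(6, v) \<in> tree_E \<longleftrightarrow> v = 5 \<or> v = 6"
  "(7, v) \<in> tree_E \<longleftrightarrow> v = 3 \<or> v = 7"
  using tree_edge_iff[of v] symD[OF tree.sym_E] by blast+

lemma tree_V_iff:
  "v \<in> tree_V \<longleftrightarrow> v = 1 \<or> v = 2 \<or> v = 3 \<or> v = 4 \<or> v = 5 \<or> v = 6 \<or> v = 7"
  by (simp add: tree_V_def)

lemmas tree_simps = tree_V_def tree_edge_iff tree_edge_iff'

lemma won_within_mono: "won_within \<sigma> \<rho> m \<Longrightarrow> m \<le> n \<Longrightarrow> won_within \<sigma> \<rho> n"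
  unfolding won_within_def by (meson order_trans)

lemma (in reflexive_graph) wins_in_mono: "wins_in \<sigma> m \<Longrightarrow> m \<le> n \<Longrightarrow> wins_in \<sigma> n"
  unfolding wins_in_def using won_within_mono by blast

subsection \<open>Corner ranks of the tree\<close>

text \<open>A vertex \<open>w\<close> other than \<open>v\<close> that corners \<open>v\<close> is
  adjacent to \<open>v\<close>, because of the loop, and to every other neighbour of
  \<open>v\<close>. If \<open>v\<close> has two neighbours, this gives a triangle, which a tree
  lacks. So only leaves qualify, and each leaf is strictly cornered by its neighbour.\<close>

lemma strict_corners_stage_1: "tree.strict_corners tree_V = {1, 6, 7}"
proof (rule set_eqI)
  fix v
  have "v \<in> {1, 6, 7}" if "v \<in> tree.strict_corners tree_V"
  proof -
    from that obtain w where "w \<noteq> v" "v \<in> tree_V"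
      and u: "\<forall>u\<in>tree_V. (u, v) \<in> tree_E \<longrightarrow> (u, w) \<in> tree_E"
      unfolding tree.strict_corners_def tree.strictly_corners_def tree.corners_def by blast
    then show ?thesis
      unfolding tree_V_def by (elim insertE emptyE; hypsubst) (auto simp: tree_simps)
  qed
  moreover have "tree.strictly_corners tree_V 2 1" "tree.strictly_corners tree_V 5 6"
    "tree.strictly_corners tree_V 3 7"
    unfolding tree.strictly_corners_def tree.corners_def by (simp_all add: tree_simps)
  ultimately show "v \<in> tree.strict_corners tree_V \<longleftrightarrow> v \<in> {1, 6, 7}"
    unfolding tree.strict_corners_def by (auto simp: tree_V_def)
qed

lemma stage_2: "tree.stage 2 = {2, 3, 4, 5}"
proof -
  have "tree.stage 2 = tree_V - tree.strict_corners tree_V"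
    by (simp only: numeral_2_eq_2 tree.stage.simps)
  also have "\<dots> = {2, 3, 4, 5}"
    unfolding strict_corners_stage_1 by (auto simp: tree_V_def)
  finally show ?thesis .
qed

text \<open>What remains is the path 2, 3, 4, 5, and the same triangle argument singles out its two
  ends.\<close>

lemma strict_corners_stage_2: "tree.strict_corners {2, 3, 4, 5} = {2, 5}"
proof (rule set_eqI)
  fix v
  let ?H = "{2, 3, 4, 5} :: nat set"
  have "v \<in> {2, 5}" if "v \<in> tree.strict_corners ?H"
  proof -
    from that obtain w where "w \<noteq> v" "v \<in> ?H"
      and u: "\<forall>u\<in>?H. (u, v) \<in> tree_E \<longrightarrow> (u, w) \<in> tree_E"
      unfolding tree.strict_corners_def tree.strictly_corners_def tree.corners_def by blast
    then show ?thesis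
      by (elim insertE emptyE; hypsubst) (auto simp: tree_simps)
  qed
  moreover have "tree.strictly_corners ?H 3 2" "tree.strictly_corners ?H 4 5"
    unfolding tree.strictly_corners_def tree.corners_def by (simp_all add: tree_simps)
  ultimately show "v \<in> tree.strict_corners ?H \<longleftrightarrow> v \<in> {2, 5}"
    unfolding tree.strict_corners_def by auto
qed

lemma stage_3: "tree.stage 3 = {3, 4}"
proof -
  have "tree.stage 3 = tree.stage 2 - tree.strict_corners (tree.stage 2)"
    by (simp only: numeral_3_eq_3 numeral_2_eq_2 tree.stage.simps)
  also have "\<dots> = {2, 3, 4, 5} - {2, 5}"
    by (simp only: stage_2 strict_corners_stage_2)
  also have "\<dots> = {3, 4}"
    by auto
  finally show ?thesis .
qed

lemma corner_rank_le:
  "k \<ge> 1 \<Longrightarrow> v \<in> tree.stage k \<Longrightarrow>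
    tree.clique (tree.stage k) \<or> v \<in> tree.strict_corners (tree.stage k) \<Longrightarrow>
    tree.corner_rank v \<le> enat k"
  unfolding tree.corner_rank_def by (rule Inf_lower) auto

lemma corner_rank_leaf: "v \<in> {1, 6, 7} \<Longrightarrow> tree.corner_rank v \<le> enat 1"
  by (rule corner_rank_le) (auto simp: strict_corners_stage_1 tree_V_iff)

text \<open>Together with the exact rank of the single vertex 3, these upper bounds determine the
  maximum.\<close>

lemma corner_rank_tree_le: "v \<in> tree_V \<Longrightarrow> tree.corner_rank v \<le> enat 3"
proof -
  assume "v \<in> tree_V"
  then consider "v \<in> {1, 6, 7}" | "v \<in> {2, 5}" | "v \<in> {3, 4}"
    by (auto simp: tree_V_def)
  then show ?thesis
  proof cases
    case 1
    then show ?thesis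
      using corner_rank_leaf by (meson enat_ord_simps(1) one_le_numeral order_trans)
  next
    case 2
    then have "tree.corner_rank v \<le> enat 2"
      by (intro corner_rank_le) (auto simp: stage_2 strict_corners_stage_2)
    then show ?thesis
      by (rule order_trans) simp
  next
    case 3
    then show ?thesis
      by (intro corner_rank_le) (auto simp: stage_3 tree.clique_def tree_V_iff tree_edge_iff)
  qed
qed

text \<open>The lower bound holds because neither of the first two stages is a clique or has 3 among
  its strict corners.\<close>

lemma corner_rank_center: "tree.corner_rank 3 = enat 3"
proof (rule antisym)
  show "tree.corner_rank 3 \<le> enat 3"
    by (rule corner_rank_tree_le) (simp add: tree_V_def)
  have "3 \<le> k" if k: "k \<ge> 1"
    "tree.clique (tree.stage k) \<or> 3 \<in> tree.strict_corners (tree.stage k)" for k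
  proof (rule ccontr)
    assume "\<not> 3 \<le> k"
    with k(1) consider "k = 1" | "k = 2"
      by linarith
    then show False
    proof cases
      case 1
      have "\<not> tree.clique tree_V"
        by (auto simp: tree.clique_def tree_simps)
      with 1 k(2) show False
        by (simp add: strict_corners_stage_1)
    next
      case 2
      have "\<not> tree.clique {2, 3, 4, 5}"
        by (auto simp: tree.clique_def tree_simps)
      with 2 k(2) show False
        by (simp add: stage_2 strict_corners_stage_2)
    qed
  qed
  then show "enat 3 \<le> tree.corner_rank 3"
    unfolding tree.corner_rank_def by (intro Inf_greatest) auto
qed

lemma graph_rank_tree: "tree.graph_rank = enat 3"
  unfolding tree.graph_rank_def
proof (rule Max_eqI)
  show "enat 3 \<in> tree.corner_rank ` tree_V"
    using corner_rank_center by (metis imageI insertCI tree_V_def)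
qed (auto simp: corner_rank_tree_le tree.finite_V)

subsection \<open>The wasteful cop\<close>

text \<open>For vertices of the tree this is one step along the unique path from \<open>c\<close> to
  \<open>r\<close>. Labels change by one along the path from 1 to 6; a distant target 7 is replaced
  by its attachment vertex 3.\<close>

definition chase :: "nat \<Rightarrow> nat \<Rightarrow> nat" where
  "chase c r =
     (if (c, r) \<in> tree_E then r
      else if c = 7 then 3
      else if c < (if r = 7 then 3 else r) then c + 1 else c - 1)"

text \<open>The test for the detour reads the whole history, not just the current positions: when
  the position (3, 7) recurs later, the cop captures.\<close>

definition wasteful_cop :: "nat cop_strat" where
  "wasteful_cop h =
     (if h = [] then 3 else if h = [(3, 7)] then 4 else chase (fst (last h)) (snd (last h)))"

lemma chase_legal: "c \<in> tree_V \<Longrightarrow> r \<in> tree_V \<Longrightarrow> (c, chase c r) \<in> tree_E"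
  unfolding tree_V_def chase_def
  by (elim insertE emptyE; hypsubst) (simp_all add: tree_simps)

text \<open>The pairs list the cop after his first move and the robber before his reply, if the game
  is still open; (4, 7) is the result of the detour.\<close>

lemma chase_first:
  assumes "r \<in> tree_V" and "c = (if r = 7 then 4 else chase 3 r)"
  shows "r = 3 \<or> c = r \<or> (c, r) \<in> {(2, 1), (4, 5), (4, 6), (4, 7)}"
  using assms(1) unfolding assms(2) tree_V_def
  by (elim insertE emptyE; hypsubst) (simp_all add: tree_simps chase_def)

text \<open>After the reply the robber is out of reach only at 6 or 7 with the cop at 4. The cop
  then steps to the neighbour of that leaf.\<close>

lemma chase_second:
  assumes "(c, r) \<in> {(2, 1), (4, 5), (4, 6), (4, 7)}" and "(r, r') \<in> tree_E"
  shows "r' = c \<or> chase c r' = r' \<or> (chase c r', r') \<in> {(5, 6), (3, 7)}"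
proof -
  have "(c, r') \<in> tree_E \<or> (c, r') \<in> {(4, 6), (4, 7)}"
    using assms by (auto simp: tree_simps)
  then show ?thesis
    by (auto simp: chase_def)
qed

text \<open>The robber is on a leaf whose only neighbour is held by the cop, so every reply stays
  within reach.\<close>

lemma chase_third:
  assumes "(c, r) \<in> {(5, 6), (3, 7)}" and "(r, r') \<in> tree_E"
  shows "r' = c \<or> chase c r' = r'"
proof -
  have "(c, r') \<in> tree_E"
    using assms by (auto simp: tree_simps)
  then show ?thesis
    by (simp add: chase_def)
qed

lemma cop_strategy_wasteful: "tree.cop_strategy wasteful_cop"
  unfolding tree.cop_strategy_def
proof (intro conjI allI impI)
  show "wasteful_cop [] \<in> tree_V"
    by (simp add: wasteful_cop_def tree_V_def)
next
  fix h :: "nat history"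
  assume h: "h \<noteq> [] \<and> set h \<subseteq> tree_V \<times> tree_V"
  then have "last h \<in> tree_V \<times> tree_V"
    using last_in_set by blast
  then have "(fst (last h), chase (fst (last h)) (snd (last h))) \<in> tree_E"
    by (auto intro: chase_legal)
  \<comment> \<open>Legality of the only move that deviates from \<open>chase\<close>.\<close>
  moreover have "(3, 4) \<in> tree_E"
    by (simp add: tree_simps)
  ultimately show "(fst (last h), wasteful_cop h) \<in> tree_E"
    using h by (simp add: wasteful_cop_def)
qed

lemma wasteful_cop_wins: "tree.wins_in wasteful_cop 3"
  unfolding tree.wins_in_def
proof (intro conjI allI impI)
  fix \<rho> :: "nat robber_strat"
  assume \<rho>: "tree.robber_strategy \<rho>"
  define c where "c = cop_pos wasteful_cop \<rho>"
  define r where "r = robber_pos wasteful_cop \<rho>"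
  define h where "h = play wasteful_cop \<rho>"
  have h0: "h 0 = []" and h_Suc: "h (Suc t) = h t @ [(c t, r t)]" for t
    by (simp_all add: h_def c_def r_def cop_pos_def robber_pos_def)
  have c: "c t = wasteful_cop (h t)" and r: "r t = \<rho> (h t) (c t)" for t
    by (simp_all add: h_def c_def r_def cop_pos_def robber_pos_def)
  have c0: "c 0 = 3"
    by (simp add: c h0 wasteful_cop_def)
  then have c0_in: "c 0 \<in> tree_V"
    by (simp add: tree_V_def)
  have c1: "c (Suc 0) = (if r 0 = 7 then 4 else chase 3 (r 0))"
    unfolding c[of "Suc 0"] h_Suc h0 c0 by (simp add: wasteful_cop_def)
  \<comment> \<open>From the second move on, the history has at least two rounds, so neither special
    case of \<open>wasteful_cop\<close> applies.\<close>
  have cs: "c (Suc (Suc t)) = chase (c (Suc t)) (r (Suc t))" for t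
    unfolding c[of "Suc (Suc t)"] h_Suc by (simp add: wasteful_cop_def)
  \<comment> \<open>History and positions are treated in one induction, since strategies are
    constrained only on histories inside the vertex set.\<close>
  have inV: "set (h t) \<subseteq> tree_V \<times> tree_V \<and> c t \<in> tree_V \<and> r t \<in> tree_V" for t
  proof (induction t)
    case 0
    then show ?case
      using \<rho> c0_in by (simp add: h0 r[of 0] tree.robber_strategy_def)
  next
    case (Suc t)
    then have h': "set (h (Suc t)) \<subseteq> tree_V \<times> tree_V" "h (Suc t) \<noteq> []"
      by (auto simp: h_Suc)
    then have "c (Suc t) \<in> tree_V"
      using cop_strategy_wasteful tree.edges_in_V
      unfolding tree.cop_strategy_def c[of "Suc t"] by blast
    then show ?case
      using h' \<rho> tree.edges_in_V \<open>c (Suc t) \<in> tree_V\<close>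
      unfolding tree.robber_strategy_def r[of "Suc t"] by blast
  qed
  have robber_move: "(r t, r (Suc t)) \<in> tree_E" for t
  proof -
    have "h (Suc t) \<noteq> []" "snd (last (h (Suc t))) = r t"
      by (simp_all add: h_Suc)
    then show ?thesis
      using \<rho> inV[of "Suc t"] unfolding tree.robber_strategy_def r[of "Suc t"] by metis
  qed
  \<comment> \<open>The two ways of winning are separated: here the robber ends a round on the cop,
    in \<open>caught\<close> the cop moves onto the robber.\<close>
  have capture: "won_within wasteful_cop \<rho> 3" if "t \<le> 3" "r t = c t" for t
    using that unfolding won_within_def c_def r_def by blast
  have caught: "won_within wasteful_cop \<rho> 3" if "Suc t \<le> 3" "c (Suc t) = r t" for t
    unfolding won_within_def using that by (intro exI[of _ "Suc t"]) (simp add: c_def r_def)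
  have "r 0 = 3 \<or> c (Suc 0) = r 0 \<or> (c (Suc 0), r 0) \<in> {(2, 1), (4, 5), (4, 6), (4, 7)}"
    using inV[of 0] c1 by (intro chase_first) simp_all
  moreover have "r (Suc 0) = c (Suc 0) \<or> c (Suc (Suc 0)) = r (Suc 0) \<or>
      (c (Suc (Suc 0)), r (Suc 0)) \<in> {(5, 6), (3, 7)}"
    if "(c (Suc 0), r 0) \<in> {(2, 1), (4, 5), (4, 6), (4, 7)}"
    unfolding cs using that robber_move by (rule chase_second)
  moreover have "r (Suc (Suc 0)) = c (Suc (Suc 0)) \<or> c (Suc (Suc (Suc 0))) = r (Suc (Suc 0))"
    if "(c (Suc (Suc 0)), r (Suc 0)) \<in> {(5, 6), (3, 7)}"
    unfolding cs[of "Suc 0"] using that robber_move by (rule chase_third)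
  ultimately show "won_within wasteful_cop \<rho> 3"
    using c0 capture[of 0] caught[of 0] capture[of "Suc 0"] caught[of "Suc 0"]
      capture[of "Suc (Suc 0)"] caught[of "Suc (Suc 0)"]
    by auto
qed (rule cop_strategy_wasteful)

subsection \<open>The lazy robber\<close>

text \<open>A stationary robber serves twice: for the lower bound on the capture time and as the
  witness against the Lower Way condition.\<close>

definition lazy_robber :: "'a \<Rightarrow> 'a robber_strat" where
  "lazy_robber x h c = (if h = [] then x else snd (last h))"

lemma robber_strategy_lazy: "x \<in> tree_V \<Longrightarrow> tree.robber_strategy (lazy_robber x)"
  unfolding tree.robber_strategy_def lazy_robber_def
  using tree.refl_E by (auto simp: refl_on_def mem_Times_iff dest!: last_in_set)

lemma robber_pos_lazy: "robber_pos \<sigma> (lazy_robber x) t = x"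
  by (induction t) (simp_all add: robber_pos_def cop_pos_def lazy_robber_def)

lemma play_in_tree:
  assumes "tree.cop_strategy \<sigma>" "x \<in> tree_V"
  shows "set (play \<sigma> (lazy_robber x) t) \<subseteq> tree_V \<times> tree_V \<and> cop_pos \<sigma> (lazy_robber x) t \<in> tree_V"
proof (induction t)
  case 0
  then show ?case
    using assms by (simp add: cop_pos_def tree.cop_strategy_def)
next
  case (Suc t)
  then have "set (play \<sigma> (lazy_robber x) (Suc t)) \<subseteq> tree_V \<times> tree_V"
    using robber_pos_lazy[of \<sigma> x t] assms(2) by (simp add: robber_pos_def cop_pos_def)
  moreover have "play \<sigma> (lazy_robber x) (Suc t) \<noteq> []"
    by simp
  ultimately show ?case
    using assms(1) tree.edges_in_V unfolding tree.cop_strategy_def cop_pos_def by blast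
qed

lemma cop_move:
  assumes "tree.cop_strategy \<sigma>" "x \<in> tree_V"
  shows "(cop_pos \<sigma> (lazy_robber x) t, cop_pos \<sigma> (lazy_robber x) (Suc t)) \<in> tree_E"
proof -
  let ?h = "play \<sigma> (lazy_robber x) (Suc t)"
  have "?h \<noteq> []" "set ?h \<subseteq> tree_V \<times> tree_V"
    using play_in_tree[OF assms, of "Suc t"] by simp_all
  then have "(fst (last ?h), \<sigma> ?h) \<in> tree_E"
    using assms(1) unfolding tree.cop_strategy_def by blast
  then show ?thesis
    by (simp add: cop_pos_def)
qed

text \<open>Vertices 1 and 6 are at distance 5, so no initial placement is within distance 2 of
  both; a robber standing still at the remoter one survives two cop moves.\<close>

lemma no_win_in_2: "\<not> tree.wins_in \<sigma> 2"
proof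
  assume wins: "tree.wins_in \<sigma> 2"
  then have \<sigma>: "tree.cop_strategy \<sigma>"
    by (simp add: tree.wins_in_def)
  \<comment> \<open>The initial placement is fixed before the robber acts, so \<open>x\<close> may
    depend on it; its distance from \<open>\<sigma> []\<close> is at least 3.\<close>
  define x :: nat where "x = (if \<sigma> [] \<in> {4, 5, 6} then 1 else 6)"
  define c where "c = cop_pos \<sigma> (lazy_robber x)"
  have x: "x \<in> tree_V"
    by (simp add: x_def tree_V_def)
  have "won_within \<sigma> (lazy_robber x) 2"
    using wins robber_strategy_lazy[OF x] by (simp add: tree.wins_in_def)
  then have "\<exists>t\<le>2. c t = x"
    by (auto simp: won_within_def robber_pos_lazy c_def)
  then have "c 0 = x \<or> c (Suc 0) = x \<or> c (Suc (Suc 0)) = x"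
    by (auto simp: numeral_2_eq_2 le_Suc_eq)
  moreover have "c 0 \<in> tree_V" "(c 0, c (Suc 0)) \<in> tree_E"
    "(c (Suc 0), c (Suc (Suc 0))) \<in> tree_E"
    using play_in_tree[OF \<sigma> x] cop_move[OF \<sigma> x] unfolding c_def by blast+
  moreover have "c 0 = \<sigma> []"
    by (simp add: c_def cop_pos_def)
  ultimately show False
    by (auto simp: tree_simps x_def)
qed

lemma capt_tree: "tree.capt = 3"
  unfolding tree.capt_def
proof (rule Least_equality)
  fix n
  assume "\<exists>\<sigma>. tree.wins_in \<sigma> n"
  then show "3 \<le> n"
    using no_win_in_2 tree.wins_in_mono by (metis not_less_eq_eq numeral_2_eq_2 numeral_3_eq_3)
qed (use wasteful_cop_wins in blast)

section \<open>Failure of the Lower Way condition\<close>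

lemma not_k_cornered_after_waste: "k \<le> 2 \<Longrightarrow> \<not> tree.k_cornered k 4 7"
proof -
  assume "k \<le> 2"
  then consider "k = 0" | "k = 1" | "k = 2"
    by linarith
  then show ?thesis
  proof cases
    case 1
    then show ?thesis
      by (simp add: tree.k_cornered_def)
  next
    case 2
    \<comment> \<open>Vertex 7 is adjacent to itself but not to 4.\<close>
    have "\<not> tree.corners (tree_V \<union> {4}) 4 7"
      unfolding tree.corners_def by (simp add: tree_simps)
    then show ?thesis
      using 2 by (simp add: tree.k_cornered_def)
  next
    case 3
    \<comment> \<open>Rank at most 1 selects the second branch of \<open>proj1 1\<close>, so 7 is
      projected to the vertices strictly cornering it, of which 3 is the only candidate.\<close>
    have "\<not> enat 1 < tree.corner_rank 7"
      using corner_rank_leaf[of 7] by simp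
    then have "tree.proj 2 {7} = {w \<in> tree.stage 2. tree.strictly_corners tree_V w 7}"
      by (simp add: numeral_2_eq_2 tree.proj_step_def tree.proj1_def)
    also have "\<dots> \<subseteq> {3}"
      unfolding stage_2 tree.strictly_corners_def tree.corners_def by (auto simp: tree_simps)
    finally have "tree.proj 2 {7} \<subseteq> {3}" .
    \<comment> \<open>Vertex 2 survives in this stage and is adjacent to 3 but not to 4.\<close>
    moreover have "\<not> tree.corners (tree.stage 2 \<union> {4}) 4 3"
      unfolding stage_2 tree.corners_def by (auto simp: tree_simps)
    ultimately show ?thesis
      using 3 by (auto simp: tree.k_cornered_def)
  qed
qed

lemma wasteful_cop_not_lower_way: "\<not> tree.lower_way wasteful_cop"
proof
  assume "tree.lower_way wasteful_cop"
  moreover have "tree.robber_strategy (lazy_robber 7)"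
    by (rule robber_strategy_lazy) (simp add: tree_V_def)
  \<comment> \<open>For \<open>t = 1\<close> only round 0 has to be free of capture, and the
    placements 3 and 7 differ.\<close>
  moreover have "\<not> won_within wasteful_cop (lazy_robber 7) 0"
    by (simp add: won_within_def robber_pos_lazy) (simp add: cop_pos_def wasteful_cop_def)
  moreover have "cop_pos wasteful_cop (lazy_robber 7) 1 = 4"
    by (simp add: cop_pos_def wasteful_cop_def lazy_robber_def)
  ultimately obtain k where "k + 1 + tree.r_val \<le> tree.rank_nat" "tree.k_cornered k 4 7"
    unfolding tree.lower_way_def by (metis diff_self_eq_0 order_refl robber_pos_lazy)
  \<comment> \<open>With \<open>t = 1\<close> and \<alpha> = 3 the bound gives
    \<open>k \<le> 2\<close>, whatever the value of \<open>tree.r_val\<close>.\<close>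
  moreover have "tree.rank_nat = 3"
    by (simp add: tree.rank_nat_def graph_rank_tree)
  ultimately show False
    using not_k_cornered_after_waste[of k] by linarith
qed

theorem theorem7p2:
  shows "\<exists>(V :: nat set) (E :: nat rel).
    reflexive_graph V E \<and>
    reflexive_graph.cop_win V E \<and>
    (\<exists>\<alpha>::nat. \<alpha> \<ge> 2 \<and> reflexive_graph.graph_rank V E = enat \<alpha>) \<and>
    (\<exists>\<sigma>. reflexive_graph.optimal V E \<sigma> \<and> \<not> reflexive_graph.lower_way V E \<sigma>)"
proof (intro exI conjI)
  show "reflexive_graph tree_V tree_E"
    by (rule tree.reflexive_graph_axioms)
  show "tree.cop_win"
    using wasteful_cop_wins unfolding tree.cop_win_def tree.wins_in_def by blast
  show "2 \<le> (3::nat)"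
    by simp
  show "tree.graph_rank = enat 3"
    by (rule graph_rank_tree)
  show "tree.optimal wasteful_cop"
    unfolding tree.optimal_def capt_tree by (rule wasteful_cop_wins)
  show "\<not> tree.lower_way wasteful_cop"
    by (rule wasteful_cop_not_lower_way)
qed

end
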